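(* Let $X$ be a complete metric space and let $f=\phi_x$ be the orbit of a point $x$ in a flow $\phi:\mathbb{R}\times X\to X$ such that $\overline{f(\mathbb{R})}$ is compact. Let $B=\{\omega_i\}$ be a maximal independent subset of $\mathcal{E}_f$, let $\omega=(\omega_1,\omega_2,\dots)$, and let $\sum_{\overline{M}}$ be the $B$-dual of (the $B$-sequence of) $\mathcal{E}_f$, formed using bases $\{b^i_j\}$ with $b^1_j=\omega_j$ for all $j$. Then there is a continuous surjection $h_f:\overline{f(\mathbb{R})}\to\sum_{\overline{M}}$ such that $\mathrm{id}\times h_f$ is a semiconjugacy from $\phi|_{\mathbb{R}\times\overline{f(\mathbb{R})}}$ to the linear flow $\Phi^{\omega}_{\overline{M}}$; that is, $h_f(\phi(t,y))=\Phi^{\omega}_{\overline{M}}(t,h_f(y))$ for all $t\in\mathbb{R}$, $y\in\overline{f(\mathbb{R})}$.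
   Context: A flow on $X$ is a continuous group action $\phi:\mathbb{R}\times X\to X$ of $(\mathbb{R},+)$; the orbit of $x$ is the map $\phi_x:t\mapsto\phi(t,x)$. Let $S^1=\mathbb{R}/\mathbb{Z}$ with quotient map $\pi:\mathbb{R}\to S^1$. The exponent group of $f$ is $\mathcal{E}_f=\{\alpha\in\mathbb{R}:\{\pi(\alpha t_i)\}\text{ converges in }S^1\text{ for every real sequence }\{t_i\}\text{ such that }\{f(t_i)\}\text{ converges in }X\}$, a subgroup of $(\mathbb{R},+)$; it is countable when $\overline{f(\mathbb{R})}$ is compact. $B$-sequence: let $H=\{h_1=0,h_2,\dots\}$ be an enumerated countable subgroup of $\mathbb{R}$ with a maximal (rationally) independent subset $B=\{b_j\}_{j=1}^{\kappa}$, where $\kappa$ is finite or $\kappa=\infty$ (countably infinite). Put $H^1=\langle B\rangle_{\mathbb{Z}}$ and $H^n=\langle H^{n-1}\cup\{h_n\}\rangle_{\mathbb{Z}}$ for $n\ge2$ ($\langle S\rangle_{\mathbb{Z}}$ is the subgroup generated by $S$), with inclusions $\beta_i^j:H^i\hookrightarrow H^j$. Each $H^i$ is free abelian; choose bases $\{b^i_j\}_{j=1}^{\kappa}$ of $H^i$, with $b^1_j=b_j$, such that $\beta_i^{i+1}$ is represented by $(M_i)^T$, where $M_i=(a_{rs})$ is a $\kappa\times\kappa$ integer matrix of nonzero determinant with $b^i_r=\sum_s a_{rs}b^{i+1}_s$ (if $\kappa<\infty$), or by $(M_i)^T\times\mathrm{id}$, where $M_i$ is an $n_i\times n_i$ integer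 matrix of nonzero determinant with $b^i_r=\sum_{s\le n_i}a_{rs}b^{i+1}_s$ for $r\le n_i$ and $b^i_r=b^{i+1}_r$ for $r>n_i$ (if $\kappa=\infty$); such bases exist. $B$-dual: let $\mathbf{T}^\kappa$ be the $\kappa$-fold product of $S^1$ (a point if $\kappa=0$). The $B$-dual is the inverse limit $\sum_{\overline{M}}=\{(x^1,x^2,\dots)\in\prod_{i\ge1}\mathbf{T}^\kappa: x^i=\alpha_i^{i+1}(x^{i+1})\text{ for all }i\}$, where $\alpha_i^{i+1}:\mathbf{T}^\kappa\to\mathbf{T}^\kappa$ is the epimorphism induced by $M_i$ (resp. $M_i\times\mathrm{id}$). It is a compact abelian group. Linear flow: with $\omega=(b_1,b_2,\dots)$, put $\pi_{\overline{M}}(t\omega)=\left(\langle\pi(tb^1_1),\pi(tb^1_2),\dots\rangle,\langle\pi(tb^2_1),\pi(tb^2_2),\dots\rangle,\dots\right)\in\sum_{\overline{M}}$; then $\Phi^{\omega}_{\overline{M}}(t,x)=\pi_{\overline{M}}(t\omega)+x$. *)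

theory Defs
  imports
    "HOL-Analysis.Analysis"
    "HOL-Computational_Algebra.Group_Closure"
    "Jordan_Normal_Form.Determinant"
begin

section \<open>The circle group\<close>

definition circle_rel :: "real \<Rightarrow> real \<Rightarrow> bool" where
  "circle_rel s t \<longleftrightarrow> s - t \<in> \<int>"

quotient_type circle = real / circle_rel
  morphisms circle_rep circle_proj
proof (rule equivpI)
  show "reflp circle_rel"
    by (simp add: reflp_def circle_rel_def)
  show "symp circle_rel"
    unfolding symp_def circle_rel_def by (metis Ints_minus minus_diff_eq)
  show "transp circle_rel"
    unfolding transp_def circle_rel_def by (metis Ints_add diff_add_cancel add_diff_eq)
qed

instantiation circle :: ab_group_add
begin

lift_definition zero_circle :: circle is 0 .

lift_definition plus_circle :: "circle \<Rightarrow> circle \<Rightarrow> circle" is "(+)"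
  unfolding circle_rel_def by (metis Ints_add add_diff_add)

lift_definition uminus_circle :: "circle \<Rightarrow> circle" is uminus
  unfolding circle_rel_def by (metis Ints_minus minus_diff_minus)

lift_definition minus_circle :: "circle \<Rightarrow> circle \<Rightarrow> circle" is "(-)"
  unfolding circle_rel_def by (metis Ints_diff diff_diff_eq add.commute diff_add_eq diff_diff_eq2)

instance
  by standard (transfer; simp add: circle_rel_def algebra_simps)+

end

lift_definition circle_zmult :: "int \<Rightarrow> circle \<Rightarrow> circle" is "\<lambda>n t. of_int n * t"
  unfolding circle_rel_def by (metis Ints_mult Ints_of_int right_diff_distrib)

instantiation circle :: topological_space
begin

definition open_circle :: "circle set \<Rightarrow> bool" where
  "open_circle U \<longleftrightarrow> open (circle_proj -` U)"

instance
proof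
  show "open (UNIV :: circle set)"
    by (simp add: open_circle_def)
  show "open (S \<inter> T)" if "open S" "open T" for S T :: "circle set"
    using that by (simp add: open_circle_def vimage_Int open_Int)
  show "open (\<Union>K)" if "\<forall>S\<in>K. open S" for K :: "circle set set"
    using that by (auto simp: open_circle_def vimage_Union)
qed

end

section \<open>Flows and exponent groups\<close>

definition is_flow :: "(real \<times> 'a::topological_space \<Rightarrow> 'a) \<Rightarrow> bool" where
  "is_flow \<phi> \<longleftrightarrow>
     continuous_on UNIV \<phi> \<and>
     (\<forall>y. \<phi> (0, y) = y) \<and>
     (\<forall>s t y. \<phi> (s + t, y) = \<phi> (s, \<phi> (t, y)))"

definition flow_orbit :: "(real \<times> 'a \<Rightarrow> 'a) \<Rightarrow> 'a \<Rightarrow> real \<Rightarrow> 'a" where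
  "flow_orbit \<phi> x = (\<lambda>t. \<phi> (t, x))"

definition exponent_group :: "(real \<Rightarrow> 'a::topological_space) \<Rightarrow> real set" where
  "exponent_group f =
     {\<alpha>. \<forall>t :: nat \<Rightarrow> real. convergent (\<lambda>i. f (t i)) \<longrightarrow>
            convergent (\<lambda>i. circle_proj (\<alpha> * t i))}"

section \<open>B-sequences\<close>

text \<open>
  A family indexed by a finite or countably infinite cardinal \<open>\<kappa>\<close> is a function on \<open>nat\<close>, of which
  only the values on \<open>idx \<kappa>\<close> matter. All indices start from 0, so the group written \<open>H\<^sup>n\<close> in
  the usual 1-based numbering is \<open>B_group B h (n - 1)\<close>, and \<open>h 0\<close> is the first element, 0, of the
  enumeration.
\<close>

definition idx :: "enat \<Rightarrow> nat set" where
  "idx \<kappa> = {j. enat j < \<kappa>}"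

abbreviation rat_independent :: "real set \<Rightarrow> bool" where
  "rat_independent S \<equiv> \<not> module.dependent (\<lambda>(q::rat) (x::real). of_rat q * x) S"

abbreviation int_independent :: "real set \<Rightarrow> bool" where
  "int_independent S \<equiv> \<not> module.dependent (\<lambda>(n::int) (x::real). of_int n * x) S"

definition maximal_independent :: "real set \<Rightarrow> real set \<Rightarrow> bool" where
  "maximal_independent H B \<longleftrightarrow>
     B \<subseteq> H \<and> rat_independent B \<and> (\<forall>x \<in> H - B. \<not> rat_independent (insert x B))"

text \<open>Repetitions are allowed, since the trivial group has no injective enumeration by \<open>nat\<close>.\<close>

definition enumerates :: "(nat \<Rightarrow> real) \<Rightarrow> real set \<Rightarrow> bool" where
  "enumerates h H \<longleftrightarrow> h 0 = 0 \<and> range h = H"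

primrec B_group :: "real set \<Rightarrow> (nat \<Rightarrow> real) \<Rightarrow> nat \<Rightarrow> real set" where
  "B_group B h 0 = group_closure B"
| "B_group B h (Suc n) = group_closure (B_group B h n \<union> {h (Suc n)})"

definition is_basis :: "enat \<Rightarrow> (nat \<Rightarrow> real) \<Rightarrow> real set \<Rightarrow> bool" where
  "is_basis \<kappa> c G \<longleftrightarrow>
     inj_on c (idx \<kappa>) \<and> int_independent (c ` idx \<kappa>) \<and> group_closure (c ` idx \<kappa>) = G"

text \<open>
  \<open>represents \<kappa> A c d\<close>: the square matrix \<open>A\<close> expresses the basis \<open>c\<close> of a subgroup in terms of the
  basis \<open>d\<close> of the larger group. If \<open>\<kappa> = \<infinity>\<close>, then \<open>A\<close> has an arbitrary finite size \<open>n\<close> and is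
  extended by the identity.
\<close>

definition represents :: "enat \<Rightarrow> int mat \<Rightarrow> (nat \<Rightarrow> real) \<Rightarrow> (nat \<Rightarrow> real) \<Rightarrow> bool" where
  "represents \<kappa> A c d \<longleftrightarrow>
     (\<exists>n. A \<in> carrier_mat n n \<and> Determinant.det A \<noteq> 0 \<and>
          (\<kappa> \<noteq> \<infinity> \<longrightarrow> \<kappa> = enat n) \<and>
          (\<forall>r<n. c r = (\<Sum>s<n. of_int (A $$ (r, s)) * d s)) \<and>
          (\<forall>r \<in> idx \<kappa>. n \<le> r \<longrightarrow> c r = d r))"

section \<open>B-duals and linear flows\<close>

text \<open>
  The torus \<open>T\<^sup>\<kappa>\<close> consists of the functions vanishing outside \<open>idx \<kappa>\<close>, with pointwise addition
  and the topology of pointwise convergence inherited from \<open>nat \<Rightarrow> circle\<close>.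
\<close>

definition torus :: "enat \<Rightarrow> (nat \<Rightarrow> circle) set" where
  "torus \<kappa> = {y. \<forall>j. j \<notin> idx \<kappa> \<longrightarrow> y j = 0}"

definition bonding_map :: "int mat \<Rightarrow> (nat \<Rightarrow> circle) \<Rightarrow> (nat \<Rightarrow> circle)" where
  "bonding_map A y =
     (\<lambda>r. if r < dim_row A then \<Sum>s<dim_col A. circle_zmult (A $$ (r, s)) (y s) else y r)"

definition B_dual :: "enat \<Rightarrow> (nat \<Rightarrow> int mat) \<Rightarrow> (nat \<Rightarrow> nat \<Rightarrow> circle) set" where
  "B_dual \<kappa> M =
     {x. (\<forall>i. x i \<in> torus \<kappa>) \<and> (\<forall>i. x i = bonding_map (M i) (x (Suc i)))}"

text \<open>The point \<open>dual_line \<kappa> b t\<close> is the image of \<open>t \<omega>\<close>, where \<open>\<omega>\<close> is the first basis \<open>b 0\<close>.\<close>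

definition dual_line :: "enat \<Rightarrow> (nat \<Rightarrow> nat \<Rightarrow> real) \<Rightarrow> real \<Rightarrow> nat \<Rightarrow> nat \<Rightarrow> circle" where
  "dual_line \<kappa> b t = (\<lambda>i j. if j \<in> idx \<kappa> then circle_proj (t * b i j) else 0)"

definition linear_flow ::
  "enat \<Rightarrow> (nat \<Rightarrow> nat \<Rightarrow> real) \<Rightarrow> real \<times> (nat \<Rightarrow> nat \<Rightarrow> circle) \<Rightarrow> (nat \<Rightarrow> nat \<Rightarrow> circle)" where
  "linear_flow \<kappa> b = (\<lambda>(t, x) i j. dual_line \<kappa> b t i j + x i j)"

end

theory Submission
  imports Defs
begin

text \<open>
  An exponent \<open>\<alpha>\<close> of \<open>f\<close> turns convergence of \<open>f (t\<^sub>n)\<close> into convergence of \<open>\<alpha> t\<^sub>n\<close> in the circle, so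
  \<open>f t \<mapsto> \<alpha> t\<close> extends to a continuous map \<open>\<chi>\<^sub>\<alpha>\<close> from the orbit closure to the circle, which
  intertwines the flow with the rotation of speed \<open>\<alpha>\<close>. Collecting the \<open>\<chi>\<^sub>\<alpha>\<close> for \<open>\<alpha> = b i j\<close> gives the
  semiconjugacy: its values lie in the inverse limit because the points of \<open>dual_line\<close> do. For
  surjectivity, Kronecker's approximation theorem for the independent numbers \<open>b i j\<close> and compactness
  of the orbit closure realise finitely many coordinates at a single level \<open>i\<close>; nested compact sets
  then give a whole level, hence all levels below it through the bonding maps, and finally all levels.
\<close>

section \<open>Topology of the circle\<close>

lemma circle_proj_add: "circle_proj (s + t) = circle_proj s + circle_proj t"
  by (simp add: plus_circle.abs_eq)

lemma circle_proj_0: "circle_proj 0 = 0"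
  by (simp add: zero_circle_def)

lemma circle_proj_minus: "circle_proj (- s) = - circle_proj s"
  by (simp add: uminus_circle.abs_eq)

lemma circle_proj_diff: "circle_proj (s - t) = circle_proj s - circle_proj t"
  by (simp add: minus_circle.abs_eq)

lemma circle_proj_sum: "circle_proj (\<Sum>i\<in>A. g i) = (\<Sum>i\<in>A. circle_proj (g i))"
  by (induction A rule: infinite_finite_induct) (auto simp: circle_proj_add circle_proj_0)

lemma circle_zmult_proj: "circle_zmult n (circle_proj t) = circle_proj (of_int n * t)"
  by (simp add: circle_zmult.abs_eq)

lemma circle_proj_eq_iff: "circle_proj s = circle_proj t \<longleftrightarrow> s - t \<in> \<int>"
  using circle.abs_eq_iff[of s t] by (simp add: circle_rel_def)

lemma circle_proj_diff_of_int: "circle_proj (t - of_int n) = circle_proj t"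
  by (simp add: circle_proj_eq_iff)

lemma surj_circle_proj: "\<exists>t. c = circle_proj t"
  by (metis Quotient3_abs_rep[OF Quotient3_circle])

section \<open>The quotient topology on the circle\<close>

lemma continuous_on_circle_iff:
  fixes g :: "circle \<Rightarrow> 'b::topological_space"
  shows "continuous_on UNIV g \<longleftrightarrow> continuous_on UNIV (\<lambda>t. g (circle_proj t))"
  by (simp add: continuous_on_open_vimage open_circle_def vimage_def)

lemma continuous_on_circle_proj: "continuous_on UNIV circle_proj"
  using continuous_on_circle_iff[of id] by simp

lemma tendsto_circle_proj [tendsto_intros]:
  "(g \<longlongrightarrow> a) F \<Longrightarrow> ((\<lambda>x. circle_proj (g x)) \<longlongrightarrow> circle_proj a) F"
  using continuous_on_tendsto_compose[OF continuous_on_circle_proj] by simp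

text \<open>The preimage of the image of \<open>U\<close> is the union of all integer translates of
  \<open>U\<close>, hence open.\<close>

lemma open_circle_proj_image:
  assumes "open U"
  shows "open (circle_proj ` U)"
proof -
  have "circle_proj -` (circle_proj ` U) = (\<Union>n::int. (+) (of_int n) ` U)"
  proof (intro equalityI subsetI)
    fix t assume "t \<in> circle_proj -` (circle_proj ` U)"
    then obtain u where "u \<in> U" "t - u \<in> \<int>"
      by (auto simp: circle_proj_eq_iff)
    then obtain n where "u \<in> U" "t = of_int n + u"
      by (metis Ints_cases diff_add_cancel)
    then show "t \<in> (\<Union>n::int. (+) (of_int n) ` U)"
      by blast
  next
    fix t assume "t \<in> (\<Union>n::int. (+) (of_int n) ` U)"
    then obtain n :: int and u where "u \<in> U" "t = of_int n + u"
      by blast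
    then show "t \<in> circle_proj -` (circle_proj ` U)"
      using circle_proj_eq_iff[of t u] by auto
  qed
  then show ?thesis
    using assms by (auto simp: open_circle_def intro!: open_translation)
qed

text \<open>The quotient map is continuous and open. Limits at a point of the circle can therefore
  be computed at any real lift of it.\<close>

lemma nhds_circle_proj: "nhds (circle_proj t) = filtermap circle_proj (nhds t)"
  using continuous_on_circle_proj
  by (intro filtermap_nhds_open_map[symmetric])
    (auto simp: continuous_on_eq_continuous_at open_circle_proj_image)

text \<open>The type \<open>circle\<close> carries a topology but no metric. This map into the plane
  supplies separation and epsilon estimates.\<close>

lift_definition circle_cis :: "circle \<Rightarrow> complex" is "\<lambda>t. cis (2 * pi * t)"
proof -
  fix s t assume "circle_rel s t"
  then obtain n where "s = t + of_int n"
    by (metis circle_rel_def Ints_cases diff_add_cancel add.commute)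
  then show "cis (2 * pi * s) = cis (2 * pi * t)"
    by (simp add: distrib_left flip: cis_mult)
qed

lemma continuous_on_circle_cis: "continuous_on UNIV circle_cis"
  by (simp add: continuous_on_circle_iff circle_cis.abs_eq) (intro continuous_intros)

lemma tendsto_circle_cis [tendsto_intros]:
  "(g \<longlongrightarrow> c) F \<Longrightarrow> ((\<lambda>x. circle_cis (g x)) \<longlongrightarrow> circle_cis c) F"
  using continuous_on_tendsto_compose[OF continuous_on_circle_cis] by simp

lemma inj_circle_cis: "inj circle_cis"
proof
  fix c d assume eq: "circle_cis c = circle_cis d"
  obtain s t where st: "c = circle_proj s" "d = circle_proj t"
    using surj_circle_proj by metis
  have "cis (2 * pi * (s - t)) = 1"
    using eq by (simp add: st circle_cis.abs_eq right_diff_distrib flip: cis_divide)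
  then have "cos (2 * pi * (s - t)) = 1"
    by (simp add: complex_eq_iff)
  then obtain n :: int where "2 * pi * (s - t) = of_int n * 2 * pi"
    using cos_one_2pi_int by blast
  then have "2 * pi * (s - t) = 2 * pi * of_int n"
    by (simp only: mult_ac)
  then have "s - t = of_int n"
    by simp
  then show "c = d"
    by (simp add: st circle_proj_eq_iff)
qed

text \<open>Disjoint neighbourhoods in the plane are pulled back along the injective continuous map
  \<open>circle_cis\<close>.\<close>

instance circle :: t2_space
proof
  fix c d :: circle
  assume "c \<noteq> d"
  then obtain U V where "open U" "open V" "circle_cis c \<in> U" "circle_cis d \<in> V" "U \<inter> V = {}"
    by (metis hausdorff inj_circle_cis injD)
  moreover have "open (circle_cis -` W)" if "open W" for W
    using continuous_on_circle_cis that by (simp add: continuous_on_open_vimage)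
  ultimately show "\<exists>U V. open U \<and> open V \<and> c \<in> U \<and> d \<in> V \<and> U \<inter> V = {}"
    by (intro exI[of _ "circle_cis -` U"] exI[of _ "circle_cis -` V"]) auto
qed

instance circle :: topological_ab_group_add
proof
  fix c d :: circle
  obtain s t where st: "c = circle_proj s" "d = circle_proj t"
    using surj_circle_proj by metis
  \<comment> \<open>Through \<open>nhds_circle_proj\<close>, continuity of both operations reduces
    to that of addition and negation of real lifts.\<close>
  have "((\<lambda>x. circle_proj (fst x + snd x)) \<longlongrightarrow> circle_proj (s + t)) (nhds s \<times>\<^sub>F nhds t)"
    by (intro tendsto_intros tendsto_add_Pair)
  then show "((\<lambda>x. fst x + snd x) \<longlongrightarrow> c + d) (nhds c \<times>\<^sub>F nhds d)"
    by (simp add: st nhds_circle_proj filterlim_filtermap circle_proj_add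
        flip: filtermap_prod_filter)
  have "((\<lambda>x. circle_proj (- x)) \<longlongrightarrow> circle_proj (- s)) (nhds s)"
    by (intro tendsto_intros filterlim_ident)
  then show "(uminus \<longlongrightarrow> - c) (nhds c)"
    by (simp only: st nhds_circle_proj filterlim_filtermap circle_proj_minus)
qed

lemma tendsto_circle_zmult [tendsto_intros]:
  assumes "(g \<longlongrightarrow> a) F"
  shows "((\<lambda>x. circle_zmult n (g x)) \<longlongrightarrow> circle_zmult n a) F"
proof -
  have "continuous_on UNIV (circle_zmult n)"
    unfolding continuous_on_circle_iff circle_zmult_proj
    by (intro continuous_on_compose2[OF continuous_on_circle_proj] continuous_intros) auto
  then show ?thesis
    using continuous_on_tendsto_compose assms by fastforce
qed

lemma compact_circle: "compact (UNIV :: circle set)"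
proof -
  have "c \<in> circle_proj ` {0..1}" for c
  proof -
    obtain t where "c = circle_proj t"
      using surj_circle_proj by blast
    also have "\<dots> = circle_proj (frac t)"
      by (simp add: circle_proj_eq_iff frac_def)
    finally show ?thesis
      by (simp add: frac_ge_0 frac_lt_1 less_imp_le)
  qed
  then have "circle_proj ` {0..1} = UNIV"
    by blast
  then show ?thesis
    by (metis compact_continuous_image compact_Icc continuous_on_circle_proj
        continuous_on_subset subset_UNIV)
qed

text \<open>By compactness \<open>circle_cis\<close> is an embedding, so continuity may be tested in the plane.\<close>

lemma continuous_on_if_circle_cis:
  assumes "continuous_on S (\<lambda>y. circle_cis (g y))"
  shows "continuous_on S g"
proof -
  have "continuous_on (range circle_cis) (inv_into UNIV circle_cis)"
    by (rule continuous_on_inv[OF continuous_on_circle_cis compact_circle])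
      (simp add: inj_circle_cis)
  from continuous_on_compose2[OF this assms] show ?thesis
    by (auto simp: inj_circle_cis)
qed

section \<open>Characters of the exponent group\<close>

text \<open>Merging two sequences of times with the same orbit limit gives one sequence to which the
  definition of an exponent applies.\<close>

lemma tendsto_interleave:
  fixes u v :: "nat \<Rightarrow> 'b::topological_space"
  assumes "u \<longlonglongrightarrow> l" "v \<longlonglongrightarrow> l"
  shows "(\<lambda>n. if even n then u (n div 2) else v (n div 2)) \<longlonglongrightarrow> l"
proof (rule topological_tendstoI)
  fix S assume "open S" "l \<in> S"
  then have "\<forall>\<^sub>F n in sequentially. u n \<in> S \<and> v n \<in> S"
    using assms by (intro eventually_conj) (auto dest: topological_tendstoD)
  then obtain N where "\<And>n. n \<ge> N \<Longrightarrow> u n \<in> S \<and> v n \<in> S"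
    by (auto simp: eventually_sequentially)
  then show "\<forall>\<^sub>F n in sequentially. (if even n then u (n div 2) else v (n div 2)) \<in> S"
    by (intro eventually_sequentiallyI[of "2 * N"]) auto
qed

text \<open>Serves the diagonal argument for continuity of characters: a limit survives
  perturbations of size at most 1/(n+1).\<close>

lemma tendsto_if_dist_less_inverse_Suc:
  fixes u v :: "nat \<Rightarrow> 'b::metric_space"
  assumes u: "u \<longlonglongrightarrow> l" and dist: "\<And>n. dist (v n) (u n) < inverse (real (Suc n))"
  shows "v \<longlonglongrightarrow> l"
proof -
  have lim: "(\<lambda>n. inverse (real (Suc n)) + dist (u n) l) \<longlonglongrightarrow> 0"
    using tendsto_add[OF LIMSEQ_inverse_real_of_nat tendsto_dist[OF u tendsto_const[of l]]] by simp
  have "dist (v n) l \<le> inverse (real (Suc n)) + dist (u n) l" for n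
    using dist_triangle[of "v n" l "u n"] dist[of n] by simp
  then have "(\<lambda>n. dist (v n) l) \<longlonglongrightarrow> 0"
    by (intro Lim_null_comparison[OF _ lim] always_eventually) simp
  then show ?thesis
    by (rule tendsto_dist_iff[THEN iffD2])
qed

section \<open>The subgroup of exponents and the groups of the B-sequence inside it\<close>

lemma exponent_group_0: "0 \<in> exponent_group f"
  by (simp add: exponent_group_def convergent_const)

lemma exponent_group_diff:
  "\<alpha> \<in> exponent_group f \<Longrightarrow> \<beta> \<in> exponent_group f \<Longrightarrow> \<alpha> - \<beta> \<in> exponent_group f"
  unfolding exponent_group_def convergent_def
  by (fastforce simp: left_diff_distrib circle_proj_diff intro: tendsto_diff)

lemma group_closure_subset_exponent_group:
  assumes "S \<subseteq> exponent_group f"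
  shows "group_closure S \<subseteq> exponent_group f"
proof
  fix \<alpha> assume "\<alpha> \<in> group_closure S"
  then show "\<alpha> \<in> exponent_group f"
    by induction (use assms exponent_group_0 exponent_group_diff in auto)
qed

lemma B_group_subset_exponent_group:
  assumes "B \<subseteq> exponent_group f" "range h \<subseteq> exponent_group f"
  shows "B_group B h n \<subseteq> exponent_group f"
  by (induction n) (use assms in \<open>auto intro!: group_closure_subset_exponent_group\<close>)

text \<open>The continuous extension of \<open>f t \<mapsto> circle_proj (\<alpha> * t)\<close>. It
  is meaningful only for an exponent \<alpha> and a point of the orbit closure; elsewhere the value
  is unspecified.\<close>

definition orbit_character :: "(real \<Rightarrow> 'a::topological_space) \<Rightarrow> real \<Rightarrow> 'a \<Rightarrow> circle" where
  "orbit_character f \<alpha> y =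
     (THE c. \<forall>t :: nat \<Rightarrow> real.
        (\<lambda>n. f (t n)) \<longlonglongrightarrow> y \<longrightarrow> (\<lambda>n. circle_proj (\<alpha> * t n)) \<longlonglongrightarrow> c)"

lemma closure_range_sequence:
  fixes f :: "real \<Rightarrow> 'a::metric_space"
  assumes "y \<in> closure (range f)"
  obtains t :: "nat \<Rightarrow> real" where "(\<lambda>n. f (t n)) \<longlonglongrightarrow> y"
proof -
  obtain u where u: "\<forall>n. u n \<in> range f" "u \<longlonglongrightarrow> y"
    using assms closure_sequential by blast
  then obtain t where "\<And>n. u n = f (t n)"
    unfolding image_iff by metis
  then have "u = (\<lambda>n. f (t n))"
    by blast
  with u that show thesis
    by blast
qed

text \<open>Being an exponent gives a limit along each sequence separately. Interleaving two
  sequences shows that these limits agree, so the description in \<open>orbit_character\<close>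
  determines a point.\<close>

lemma tendsto_orbit_character:
  fixes f :: "real \<Rightarrow> 'a::metric_space"
  assumes \<alpha>: "\<alpha> \<in> exponent_group f" and t: "(\<lambda>n. f (t n)) \<longlonglongrightarrow> y"
  shows "(\<lambda>n. circle_proj (\<alpha> * t n)) \<longlonglongrightarrow> orbit_character f \<alpha> y"
proof -
  obtain c where c: "(\<lambda>n. circle_proj (\<alpha> * t n)) \<longlonglongrightarrow> c"
    using assms unfolding exponent_group_def convergent_def by blast
  have lim: "(\<lambda>n. circle_proj (\<alpha> * s n)) \<longlonglongrightarrow> c" if s: "(\<lambda>n. f (s n)) \<longlonglongrightarrow> y" for s
  proof -
    define u where "u n = (if even n then s (n div 2) else t (n div 2))" for n
    have "(\<lambda>n. f (u n)) \<longlonglongrightarrow> y"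
      using tendsto_interleave[OF s t] by (simp add: u_def if_distrib[of f])
    then obtain d where d: "(\<lambda>n. circle_proj (\<alpha> * u n)) \<longlonglongrightarrow> d"
      using \<alpha> unfolding exponent_group_def convergent_def by blast
    \<comment> \<open>The even and odd subsequences of \<open>u\<close> recover \<open>s\<close> and
      \<open>t\<close>, which forces their limits to coincide.\<close>
    have "(\<lambda>n. circle_proj (\<alpha> * s n)) \<longlonglongrightarrow> d"
      using LIMSEQ_subseq_LIMSEQ[OF d, of "\<lambda>n. 2 * n"] by (simp add: o_def u_def strict_mono_def)
    moreover have "(\<lambda>n. circle_proj (\<alpha> * t n)) \<longlonglongrightarrow> d"
      using LIMSEQ_subseq_LIMSEQ[OF d, of "\<lambda>n. 2 * n + 1"] by (simp add: o_def u_def strict_mono_def)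
    ultimately show ?thesis
      using c LIMSEQ_unique by blast
  qed
  have "orbit_character f \<alpha> y = c"
    unfolding orbit_character_def
  proof (rule the_equality)
    show "\<forall>s. (\<lambda>n. f (s n)) \<longlonglongrightarrow> y \<longrightarrow> (\<lambda>n. circle_proj (\<alpha> * s n)) \<longlonglongrightarrow> c"
      using lim by blast
  next
    fix d
    assume "\<forall>s. (\<lambda>n. f (s n)) \<longlonglongrightarrow> y \<longrightarrow> (\<lambda>n. circle_proj (\<alpha> * s n)) \<longlonglongrightarrow> d"
    then show "d = c"
      using t c LIMSEQ_unique by blast
  qed
  with c show ?thesis
    by simp
qed

text \<open>A diagonal argument: each point of a convergent sequence in the closure is replaced by a
  nearby orbit point with nearly the same character value, and along orbit points the limit is
  known.\<close>

lemma continuous_on_orbit_character: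
  fixes f :: "real \<Rightarrow> 'a::metric_space"
  assumes \<alpha>: "\<alpha> \<in> exponent_group f"
  shows "continuous_on (closure (range f)) (orbit_character f \<alpha>)"
proof (rule continuous_on_if_circle_cis, rule continuous_on_sequentiallyI)
  fix u a
  assume u: "\<forall>n. u n \<in> closure (range f)" "u \<longlonglongrightarrow> a"
  let ?E = "\<lambda>c. circle_cis c" and ?\<chi> = "orbit_character f \<alpha>"
  have E_lim: "(\<lambda>n. ?E (circle_proj (\<alpha> * t n))) \<longlonglongrightarrow> ?E (?\<chi> y)"
    if "(\<lambda>n. f (t n)) \<longlonglongrightarrow> y" for t y
    by (rule tendsto_circle_cis[OF tendsto_orbit_character[OF \<alpha> that]])
  \<comment> \<open>One time has to be close in both senses at once; a late enough term of a
    sequence of orbit points tending to \<open>u n\<close> is.\<close>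
  have "\<exists>t. dist (f t) (u n) < inverse (real (Suc n)) \<and>
      dist (?E (circle_proj (\<alpha> * t))) (?E (?\<chi> (u n))) < inverse (real (Suc n))" for n
  proof -
    obtain t where t: "(\<lambda>k. f (t k)) \<longlonglongrightarrow> u n"
      by (rule closure_range_sequence[OF u(1)[rule_format]])
    have "\<forall>\<^sub>F k in sequentially. dist (f (t k)) (u n) < inverse (real (Suc n)) \<and>
        dist (?E (circle_proj (\<alpha> * t k))) (?E (?\<chi> (u n))) < inverse (real (Suc n))"
      by (intro eventually_conj tendstoD[OF t] tendstoD[OF E_lim[OF t]]) auto
    from eventually_happens'[OF sequentially_bot this] show ?thesis
      by (elim exE) (rule exI)
  qed
  then obtain t where t: "\<And>n. dist (f (t n)) (u n) < inverse (real (Suc n))"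
    "\<And>n. dist (?E (circle_proj (\<alpha> * t n))) (?E (?\<chi> (u n))) < inverse (real (Suc n))"
    by metis
  have "(\<lambda>n. f (t n)) \<longlonglongrightarrow> a"
    by (rule tendsto_if_dist_less_inverse_Suc[OF u(2) t(1)])
  then have "(\<lambda>n. ?E (circle_proj (\<alpha> * t n))) \<longlonglongrightarrow> ?E (?\<chi> a)"
    by (rule E_lim)
  then show "(\<lambda>n. ?E (?\<chi> (u n))) \<longlonglongrightarrow> ?E (?\<chi> a)"
    by (rule tendsto_if_dist_less_inverse_Suc) (subst dist_commute, rule t(2))
qed

text \<open>If \<open>f (t n)\<close> tends to \<open>y\<close>, then \<open>f (s + t n)\<close>
  tends to \<open>\<phi> (s, y)\<close> by continuity of the flow, and the multiple of
  \<open>s + t n\<close> by \<alpha> splits into a constant rotation and the sequence defining the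
  value at \<open>y\<close>.\<close>

lemma orbit_character_flow:
  fixes \<phi> :: "real \<times> 'a::metric_space \<Rightarrow> 'a"
  assumes "is_flow \<phi>" and \<alpha>: "\<alpha> \<in> exponent_group (flow_orbit \<phi> x)"
    and y: "y \<in> closure (range (flow_orbit \<phi> x))"
  shows "orbit_character (flow_orbit \<phi> x) \<alpha> (\<phi> (s, y)) =
    circle_proj (s * \<alpha>) + orbit_character (flow_orbit \<phi> x) \<alpha> y"
proof -
  let ?f = "flow_orbit \<phi> x"
  obtain t where t: "(\<lambda>n. ?f (t n)) \<longlonglongrightarrow> y"
    by (rule closure_range_sequence[OF y])
  have "continuous_on UNIV \<phi>"
    using assms(1) by (simp add: is_flow_def)
  then have "(\<lambda>n. \<phi> (s, ?f (t n))) \<longlonglongrightarrow> \<phi> (s, y)"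
    using continuous_on_tendsto_compose[of UNIV \<phi> "\<lambda>n. (s, ?f (t n))" "(s, y)"] t
    by (simp add: tendsto_Pair)
  moreover have "\<phi> (s, ?f (t n)) = ?f (s + t n)" for n
    using assms(1) unfolding is_flow_def flow_orbit_def by metis
  ultimately have "(\<lambda>n. ?f (s + t n)) \<longlonglongrightarrow> \<phi> (s, y)"
    by simp
  from tendsto_orbit_character[OF \<alpha> this]
  have "(\<lambda>n. circle_proj (s * \<alpha>) + circle_proj (\<alpha> * t n))
      \<longlonglongrightarrow> orbit_character ?f \<alpha> (\<phi> (s, y))"
    by (simp add: distrib_left circle_proj_add mult.commute[of s])
  moreover have "(\<lambda>n. circle_proj (s * \<alpha>) + circle_proj (\<alpha> * t n))
      \<longlonglongrightarrow> circle_proj (s * \<alpha>) + orbit_character ?f \<alpha> y"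
    by (intro tendsto_intros tendsto_orbit_character[OF \<alpha> t])
  ultimately show ?thesis
    using LIMSEQ_unique by blast
qed

section \<open>The map to the dual\<close>

text \<open>The finite intersection property, where initial segments of indices suffice because
  every finite index set lies in one.\<close>

lemma compact_Int_nested:
  fixes C :: "nat \<Rightarrow> 'a::topological_space set"
  assumes "compact S" "\<And>m. closed (C m)" "\<And>n. S \<inter> (\<Inter>m<n. C m) \<noteq> {}"
  shows "S \<inter> (\<Inter>m. C m) \<noteq> {}"
proof (rule compact_imp_fip_image[OF assms(1,2)])
  fix I :: "nat set" assume "finite I"
  then obtain n where "I \<subseteq> {..<n}"
    by (meson finite_nat_iff_bounded)
  then show "S \<inter> (\<Inter>m\<in>I. C m) \<noteq> {}"
    using assms(3)[of n] by blast
qed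

section \<open>Kronecker approximation on finitely many coordinates\<close>

lemma idx_Int_lessThan: "\<exists>m. idx \<kappa> \<inter> {..<n} = {..<m}"
proof (cases \<kappa>)
  case (enat k)
  then show ?thesis
    by (intro exI[of _ "min k n"]) (auto simp: idx_def)
next
  case infinity
  then show ?thesis
    by (intro exI[of _ n]) (auto simp: idx_def)
qed

text \<open>Kronecker's theorem handles finitely many numbers, hence the bound \<open>n\<close> when
  \<kappa> may be infinite. Its integer corrections vanish in the circle. Since the times are real,
  independence of the numbers \<open>c j\<close> alone, without 1 among them, is enough.\<close>

lemma Kronecker_circle:
  assumes inj: "inj_on c (idx \<kappa>)" and indep: "int_independent (c ` idx \<kappa>)"
  obtains t :: "nat \<Rightarrow> real"
  where "\<And>j. j \<in> idx \<kappa> \<Longrightarrow> j < n \<Longrightarrow> (\<lambda>k. circle_proj (c j * t k)) \<longlonglongrightarrow> z j"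
proof -
  interpret int_module: Modules.module "\<lambda>(n::int) (x::real). of_int n * x"
    by unfold_locales (auto simp: algebra_simps)
  have "\<forall>j. \<exists>s. z j = circle_proj s"
    using surj_circle_proj by blast
  then obtain \<theta> where \<theta>: "\<And>j. z j = circle_proj (\<theta> j)"
    by metis
  obtain m where m: "idx \<kappa> \<inter> {..<n} = {..<m}"
    using idx_Int_lessThan by blast
  have inj_m: "inj_on c {..<m}"
    using inj m by (metis inf_le1 inj_on_subset)
  have indep_m: "int_independent (c ` {..<m})"
    using int_module.dependent_mono[of "c ` {..<m}" "c ` idx \<kappa>"] indep m by blast
  \<comment> \<open>The errors 1/(k+1) turn approximation to any precision into a sequence of
    times.\<close>
  have "\<exists>t g. \<forall>j<m. \<bar>t * c j - of_int (g j) - \<theta> j\<bar> < inverse (real (Suc k))" for k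
  proof -
    have "0 < inverse (real (Suc k))"
      by simp
    from Kronecker_thm_1[OF indep_m inj_m this, of \<theta>] show ?thesis
      by metis
  qed
  then obtain t g where tg:
    "\<And>k j. j < m \<Longrightarrow> \<bar>t k * c j - of_int (g k j) - \<theta> j\<bar> < inverse (real (Suc k))"
    by metis
  have "(\<lambda>k. circle_proj (c j * t k)) \<longlonglongrightarrow> z j" if "j \<in> idx \<kappa>" "j < n" for j
  proof -
    have "j < m"
      using m that by blast
    have "(\<lambda>k. t k * c j - of_int (g k j) - \<theta> j) \<longlonglongrightarrow> 0"
      by (rule Lim_null_comparison[OF _ LIMSEQ_inverse_real_of_nat])
        (use tg[OF \<open>j < m\<close>] in \<open>auto intro!: always_eventually less_imp_le\<close>)
    then have "(\<lambda>k. t k * c j - of_int (g k j)) \<longlonglongrightarrow> \<theta> j"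
      by (simp add: LIM_zero_iff)
    then have "(\<lambda>k. circle_proj (t k * c j - of_int (g k j))) \<longlonglongrightarrow> circle_proj (\<theta> j)"
      by (rule tendsto_circle_proj)
    then show ?thesis
      by (simp add: \<theta> circle_proj_diff_of_int mult.commute)
  qed
  then show thesis
    by (rule that)
qed

section \<open>Compatibility of the line with the bonding maps\<close>

lemma dual_line_bonding:
  assumes "represents \<kappa> A (b i) (b (Suc i))"
  shows "dual_line \<kappa> b t i = bonding_map A (dual_line \<kappa> b t (Suc i))"
proof
  fix r
  obtain n where A: "A \<in> carrier_mat n n" and n: "\<kappa> \<noteq> \<infinity> \<longrightarrow> \<kappa> = enat n"
    and small: "\<forall>r<n. b i r = (\<Sum>s<n. of_int (A $$ (r, s)) * b (Suc i) s)"
    and large: "\<forall>r \<in> idx \<kappa>. n \<le> r \<longrightarrow> b i r = b (Suc i) r"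
    using assms unfolding represents_def by blast
  \<comment> \<open>Every column index of the matrix is a genuine coordinate, so the default value 0
    of \<open>dual_line\<close> does not enter the sum.\<close>
  have idx: "s \<in> idx \<kappa>" if "s < n" for s
    using n that by (cases \<kappa>) (auto simp: idx_def)
  show "dual_line \<kappa> b t i r = bonding_map A (dual_line \<kappa> b t (Suc i)) r"
  proof (cases "r < n")
    case True
    have "circle_proj (t * b i r) =
        (\<Sum>s<n. circle_zmult (A $$ (r, s)) (circle_proj (t * b (Suc i) s)))"
      using small True
      by (simp add: sum_distrib_left circle_proj_sum circle_zmult_proj mult.left_commute)
    then show ?thesis
      using A True idx by (simp add: dual_line_def bonding_map_def)
  next
    case False
    then show ?thesis
      using A large by (auto simp: dual_line_def bonding_map_def)
  qed
qed

lemma tendsto_bonding_map: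
  assumes "\<And>j. (\<lambda>n. y n j) \<longlonglongrightarrow> z j"
  shows "(\<lambda>n. bonding_map A (y n) r) \<longlonglongrightarrow> bonding_map A z r"
  unfolding bonding_map_def using assms by (auto intro!: tendsto_intros)

theorem theorem10:
  fixes \<phi> :: "real \<times> 'a::complete_space \<Rightarrow> 'a"
    and x :: 'a
    and f :: "real \<Rightarrow> 'a"
    and \<kappa> :: enat
    and \<omega> h :: "nat \<Rightarrow> real"
    and b :: "nat \<Rightarrow> nat \<Rightarrow> real"
    and M :: "nat \<Rightarrow> int mat"
  assumes "is_flow \<phi>"
    and "f = flow_orbit \<phi> x"
    and "compact (closure (range f))"
    and "inj_on \<omega> (idx \<kappa>)"
    and "maximal_independent (exponent_group f) (\<omega> ` idx \<kappa>)"
    and "enumerates h (exponent_group f)"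
    and "\<forall>i. is_basis \<kappa> (b i) (B_group (\<omega> ` idx \<kappa>) h i)"
    and "\<forall>j \<in> idx \<kappa>. b 0 j = \<omega> j"
    and "\<forall>i. represents \<kappa> (M i) (b i) (b (Suc i))"
  shows "\<exists>h\<^sub>f :: 'a \<Rightarrow> nat \<Rightarrow> nat \<Rightarrow> circle.
           continuous_on (closure (range f)) h\<^sub>f \<and>
           h\<^sub>f ` closure (range f) = B_dual \<kappa> M \<and>
           (\<forall>t. \<forall>y \<in> closure (range f). h\<^sub>f (\<phi> (t, y)) = linear_flow \<kappa> b (t, h\<^sub>f y))"
proof -
  define K where "K = closure (range f)"
  have compact_K: "compact K"
    using assms(3) by (simp add: K_def)
  \<comment> \<open>The default 0 off \<open>idx \<kappa>\<close> matches the convention for points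
    of \<open>torus \<kappa>\<close>.\<close>
  define H where
    "H y i j = (if j \<in> idx \<kappa> then orbit_character f (b i j) y else 0)" for y i j
  have b_mem: "b i j \<in> exponent_group f" if "j \<in> idx \<kappa>" for i j
  proof -
    have "b i j \<in> group_closure (b i ` idx \<kappa>)"
      using that by (intro group_closure.base) blast
    also have "\<dots> = B_group (\<omega> ` idx \<kappa>) h i"
      using assms(7) by (simp add: is_basis_def)
    also have "\<dots> \<subseteq> exponent_group f"
      using assms(5,6) by (intro B_group_subset_exponent_group)
        (auto simp: maximal_independent_def enumerates_def)
    finally show ?thesis .
  qed
  \<comment> \<open>\<open>H y\<close> is a coordinatewise limit of points of the line, so relations
    that hold on the line and are preserved by limits pass to \<open>H y\<close>.\<close>
  have lim: "(\<lambda>n. dual_line \<kappa> b (t n) i j) \<longlonglongrightarrow> H y i j" if "(\<lambda>n. f (t n)) \<longlonglongrightarrow> y" for t y i j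
    using tendsto_orbit_character[OF b_mem that]
    by (simp add: H_def dual_line_def mult.commute)
  have cont: "continuous_on K (\<lambda>y. H y i j)" for i j
    by (cases "j \<in> idx \<kappa>")
      (auto simp: H_def K_def intro!: continuous_on_orbit_character b_mem)
  have bonding: "H y i = bonding_map (M i) (H y (Suc i))" if y: "y \<in> K" for y i
  proof
    fix r
    obtain t where t: "(\<lambda>n. f (t n)) \<longlonglongrightarrow> y"
      by (rule closure_range_sequence[OF y[unfolded K_def]])
    have "(\<lambda>n. bonding_map (M i) (dual_line \<kappa> b (t n) (Suc i)) r)
        \<longlonglongrightarrow> bonding_map (M i) (H y (Suc i)) r"
      by (rule tendsto_bonding_map, rule lim, rule t)
    moreover have "dual_line \<kappa> b s i r = bonding_map (M i) (dual_line \<kappa> b s (Suc i)) r" for s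
      using dual_line_bonding[of \<kappa> "M i" b i s] assms(9) by simp
    ultimately have "(\<lambda>n. dual_line \<kappa> b (t n) i r) \<longlonglongrightarrow> bonding_map (M i) (H y (Suc i)) r"
      by simp
    then show "H y i r = bonding_map (M i) (H y (Suc i)) r"
      by (rule LIMSEQ_unique[OF lim[OF t]])
  qed
  have "H y \<in> B_dual \<kappa> M" if "y \<in> K" for y
  proof -
    have "H y i \<in> torus \<kappa>" for i
      by (simp add: torus_def H_def)
    with bonding[OF that] show ?thesis
      unfolding B_dual_def by blast
  qed
  moreover have "z \<in> H ` K" if z: "z \<in> B_dual \<kappa> M" for z
  proof -
    have z0: "z i j = 0" if "j \<notin> idx \<kappa>" for i j
      using z that unfolding B_dual_def torus_def by blast
    have closed: "closed {y \<in> K. H y i j = z i j}" for i j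
      using cont by (intro continuous_closed_preimage_constant) (auto simp: K_def)
    \<comment> \<open>First only finitely many coordinates of a single level are matched, which is
      what Kronecker's theorem allows.\<close>
    have level_j: "K \<inter> (\<Inter>j<n. {y \<in> K. H y i j = z i j}) \<noteq> {}" for i n
    proof -
      obtain t where t:
        "\<And>j. j \<in> idx \<kappa> \<Longrightarrow> j < n \<Longrightarrow> (\<lambda>k. circle_proj (b i j * t k)) \<longlonglongrightarrow> z i j"
        using Kronecker_circle[of "b i" \<kappa> n "z i"] assms(7) by (auto simp: is_basis_def)
      have "\<forall>k. f (t k) \<in> K"
        using closure_subset[of "range f"] by (auto simp: K_def)
      \<comment> \<open>The orbit need not converge along the Kronecker times. Compactness gives a
        subsequence along which it does, and the circle limits persist there.\<close>
      then obtain y r where y: "y \<in> K" "strict_mono r" "(\<lambda>k. f (t (r k))) \<longlonglongrightarrow> y"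
        using seq_compactE[of K "\<lambda>k. f (t k)"] compact_K
        unfolding compact_eq_seq_compact_metric o_def by metis
      have "H y i j = z i j" if "j < n" for j
      proof (cases "j \<in> idx \<kappa>")
        case True
        from LIMSEQ_subseq_LIMSEQ[OF t[OF this that] y(2)]
        have "(\<lambda>k. dual_line \<kappa> b (t (r k)) i j) \<longlonglongrightarrow> z i j"
          using True by (simp add: o_def dual_line_def mult.commute)
        then show ?thesis
          by (rule LIMSEQ_unique[OF lim[OF y(3)]])
      qed (simp add: H_def z0)
      with y(1) show ?thesis
        by blast
    qed
    define C where "C i = {y \<in> K. H y i = z i}" for i
    have C_eq: "C i = K \<inter> (\<Inter>j. {y \<in> K. H y i j = z i j})" for i
      by (auto simp: C_def fun_eq_iff)
    have "closed (C i)" for i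
      unfolding C_eq by (intro closed_Int closed_INT ballI closed) (simp add: K_def)
    moreover have "K \<inter> (\<Inter>i<n. C i) \<noteq> {}" for n
    proof -
      \<comment> \<open>Matching level \<open>n\<close> alone forces all lower levels through the
        bonding maps. Taking \<open>n\<close> rather than \<open>n - 1\<close> avoids a separate
        case for 0.\<close>
      have "C n \<noteq> {}"
        unfolding C_eq by (rule compact_Int_nested[OF compact_K closed level_j])
      then obtain y where y: "y \<in> K" "H y n = z n"
        by (auto simp: C_def)
      have "H y i = z i" if "i \<le> n" for i
        using that
      \<comment> \<open>Induction descends from level \<open>n\<close>, since bonding maps determine
        level \<open>i\<close> from level \<open>Suc i\<close>.\<close>
      proof (induction rule: inc_induct)
        case (step i)
        have "z i = bonding_map (M i) (z (Suc i))"
          using z unfolding B_dual_def by blast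
        with step(3) bonding[OF y(1), of i] show ?case
          by simp
      qed (rule y(2))
      with y(1) show ?thesis
        by (auto simp: C_def)
    qed
    ultimately have "K \<inter> (\<Inter>i. C i) \<noteq> {}"
      by (rule compact_Int_nested[OF compact_K])
    then obtain y where "y \<in> K" "\<And>i. H y i = z i"
      by (auto simp: C_def)
    then have "z = H y"
      by auto
    with \<open>y \<in> K\<close> show ?thesis
      by blast
  qed
  ultimately have "H ` K = B_dual \<kappa> M"
    by blast
  moreover have "continuous_on K H"
    \<comment> \<open>Both function spaces carry the product topology, so the coordinate maps decide
      continuity.\<close>
    by (intro continuous_on_coordinatewise_then_product cont)
  moreover have "H (\<phi> (t, y)) = linear_flow \<kappa> b (t, H y)" if "y \<in> K" for t y
    using orbit_character_flow[OF assms(1), of _ x y t] b_mem that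
    by (auto simp: fun_eq_iff H_def linear_flow_def dual_line_def K_def assms(2))
  ultimately show ?thesis
    unfolding K_def by blast
qed

end
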